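(* Let $d,n\geq 1$ be integers and let $\mathcal{H}=\mathbb{C}^d$. There exists a symmetric weighted design $(X,\omega)$ for $S_n$ (acting on $\mathcal{H}^{\otimes n}$) such that $$|X|\leq d^{4n}+1 .$$
   Context: $S_n$ is the group of all permutations of $\{1,\dots,n\}$. For $\pi\in S_n$, $U^{\pi}$ is the unitary on $(\mathbb{C}^d)^{\otimes n}$ defined by $U^{\pi}(x_1\otimes\cdots\otimes x_n)=x_{\pi(1)}\otimes\cdots\otimes x_{\pi(n)}$ for $x_1,\dots,x_n\in\mathbb{C}^d$. $\mathcal{L}(\mathcal{H}^{\otimes n})$ denotes the linear operators on $\mathcal{H}^{\otimes n}$. Definition (symmetric weighted design, or weighted design for $S_n$): let $X\subset S_n$ and let $\omega:X\to\mathbb{R}^+$ be a weight function, i.e. $\omega(\pi)>0$ for all $\pi\in X$ and $\sum_{\pi\in X}\omega(\pi)=1$. The pair $(X,\omega)$ is a symmetric weighted design if $$\frac{1}{n!}\sum_{\pi\in S_n}U^{\pi}\eta\,{U^{\pi}}^{\dagger}=\sum_{\pi\in X}\omega(\pi)\,U^{\pi}\eta\,{U^{\pi}}^{\dagger}\quad\text{for all }\eta\in\mathcal{L}(\mathcal{H}^{\otimes n}).$$ *)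

theory Defs
  imports "HOL-Analysis.Analysis"
begin

text \<open>
  The dimensions \<open>d\<close> and \<open>n\<close> are the cardinalities of finite index types \<open>'d\<close> and \<open>'n\<close>.
  The tensor power \<open>(\<complex>\<^sup>d)\<^sup>\<otimes>\<^sup>n\<close> is modelled by its coordinates in the product basis
  \<open>e\<^bsub>k 1\<^esub> \<otimes> \<dots> \<otimes> e\<^bsub>k n\<^esub>\<close>, which is indexed by the multi-indices \<open>k :: 'n \<Rightarrow> 'd\<close>; its
  linear operators are the square matrices over these multi-indices.
\<close>

type_synonym ('d, 'n) tpow = "(complex, 'n \<Rightarrow> 'd) vec"
type_synonym ('d, 'n) tpow_op = "((complex, 'n \<Rightarrow> 'd) vec, 'n \<Rightarrow> 'd) vec"

definition elem_tensor :: "('n::finite \<Rightarrow> complex ^ 'd::finite) \<Rightarrow> ('d, 'n) tpow" where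
  "elem_tensor x = (\<chi> k. \<Prod>i\<in>UNIV. x i $ k i)"

definition cadjoint :: "complex ^ 'a ^ 'b \<Rightarrow> complex ^ 'b ^ 'a" where
  "cadjoint A = (\<chi> i j. cnj (A $ j $ i))"

definition sym_group :: "('n::finite \<Rightarrow> 'n) set" where
  "sym_group = {p. p permutes UNIV}"

text \<open>
  The operator is determined by its values on elementary tensors; see \<open>perm_op_ex1\<close> below for
  existence and uniqueness.
\<close>

definition perm_op :: "('n::finite \<Rightarrow> 'n) \<Rightarrow> ('d::finite, 'n) tpow_op" where
  "perm_op p = (THE U. \<forall>x. U *v elem_tensor x = elem_tensor (\<lambda>i. x (p i)))"

text \<open>
  The weight function is total on the function type, but only its values on \<open>X\<close> matter. The
  argument of type \<open>'d itself\<close> fixes the underlying space \<open>\<complex>\<^sup>d\<close>.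
\<close>

definition symmetric_weighted_design ::
    "'d::finite itself \<Rightarrow> ('n::finite \<Rightarrow> 'n) set \<Rightarrow> (('n \<Rightarrow> 'n) \<Rightarrow> real) \<Rightarrow> bool" where
  "symmetric_weighted_design _ X \<omega> \<longleftrightarrow>
     X \<subseteq> sym_group \<and> (\<forall>p\<in>X. \<omega> p > 0) \<and> (\<Sum>p\<in>X. \<omega> p) = 1 \<and>
     (\<forall>\<eta> :: ('d, 'n) tpow_op.
        (1 / fact CARD('n)) *\<^sub>R (\<Sum>p\<in>sym_group. perm_op p ** \<eta> ** cadjoint (perm_op p)) =
        (\<Sum>p\<in>X. \<omega> p *\<^sub>R (perm_op p ** \<eta> ** cadjoint (perm_op p))))"

lemma elem_tensor_axis: "elem_tensor (\<lambda>i. axis (k i) 1) = axis k 1"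
proof (rule vec_eq_iff[THEN iffD2], rule allI)
  fix l
  show "elem_tensor (\<lambda>i. axis (k i) 1) $ l = axis k (1::complex) $ l"
  proof (cases "l = k")
    case False
    then obtain i where "l i \<noteq> k i" by auto
    then have "(\<Prod>i\<in>UNIV. axis (k i) (1::complex) $ l i) = 0"
      by (intro prod_zero) (auto simp: axis_def)
    with False show ?thesis by (simp add: elem_tensor_def axis_def)
  qed (simp add: elem_tensor_def axis_def)
qed

lemma perm_mat_elem_tensor:
  fixes x :: "'n::finite \<Rightarrow> complex ^ 'd::finite"
  assumes "p \<in> sym_group"
  shows "(\<chi> k l. if k = l \<circ> p then 1 else 0) *v elem_tensor x = elem_tensor (\<lambda>i. x (p i))"
proof (rule vec_eq_iff[THEN iffD2], rule allI)
  fix k :: "'n \<Rightarrow> 'd"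
  have b: "bij p" using assms by (simp add: sym_group_def permutes_bij)
  then have inv: "p \<circ> inv p = id" "inv p \<circ> p = id"
    by (auto simp: fun_eq_iff bij_is_surj bij_is_inj surj_f_inv_f)
  then have eq: "k = l \<circ> p \<longleftrightarrow> l = k \<circ> inv p" for l
    by (metis comp_assoc comp_id)
  have "((\<chi> k l. if k = l \<circ> p then 1 else 0) *v elem_tensor x) $ k = elem_tensor x $ (k \<circ> inv p)"
    by (simp add: matrix_vector_mult_def eq if_distrib[of "\<lambda>c. c * _"] cong: if_cong)
  also have "\<dots> = (\<Prod>j\<in>UNIV. x j $ k (inv p j))" by (simp add: elem_tensor_def)
  also have "\<dots> = (\<Prod>i\<in>UNIV. x (p i) $ k i)"
    using b by (subst prod.reindex_bij_betw[OF b, symmetric]) (simp add: bij_is_inj)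
  finally show "((\<chi> k l. if k = l \<circ> p then 1 else 0) *v elem_tensor x) $ k =
      elem_tensor (\<lambda>i. x (p i)) $ k" by (simp add: elem_tensor_def)
qed

lemma elem_tensor_mat_eqI:
  fixes U V :: "('d::finite, 'n::finite) tpow_op"
  assumes "\<And>x. U *v elem_tensor x = V *v elem_tensor x"
  shows "U = V"
proof -
  have col: "(A *v axis k 1) $ l = A $ l $ k" for A :: "('d, 'n) tpow_op" and k l
    by (simp add: matrix_vector_mult_def axis_def if_distrib[of "\<lambda>c. _ * c"] cong: if_cong)
  have "U *v axis k 1 = V *v axis k 1" for k
    using assms[of "\<lambda>i. axis (k i) 1"] by (simp add: elem_tensor_axis)
  then show ?thesis by (metis col vec_eq_iff)
qed

lemma perm_op_ex1:
  assumes "p \<in> sym_group"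
  shows "\<exists>!U :: ('d::finite, 'n::finite) tpow_op.
           \<forall>x. U *v elem_tensor x = elem_tensor (\<lambda>i. x (p i))"
proof (rule ex1I)
  show "\<forall>x. (\<chi> k l. if k = l \<circ> p then 1 else 0) *v elem_tensor x = elem_tensor (\<lambda>i. x (p i))"
    using perm_mat_elem_tensor[OF assms] by blast
qed (auto intro!: elem_tensor_mat_eqI simp: perm_mat_elem_tensor[OF assms])

lemma perm_op_elem_tensor:
  "p \<in> sym_group \<Longrightarrow> perm_op p *v elem_tensor x = elem_tensor (\<lambda>i. x (p i))"
  unfolding perm_op_def by (rule theI'[OF perm_op_ex1, THEN spec])

lemma perm_op_eq:
  "p \<in> sym_group \<Longrightarrow> perm_op p = (\<chi> k l. if k = l \<circ> p then 1 else 0)"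
  by (rule elem_tensor_mat_eqI) (simp add: perm_op_elem_tensor perm_mat_elem_tensor)

lemma perm_op_unitary:
  fixes p :: "'n::finite \<Rightarrow> 'n"
  assumes "p \<in> sym_group"
  shows "cadjoint (perm_op p) ** perm_op p = (mat 1 :: ('d::finite, 'n) tpow_op)"
proof -
  have "surj p" using assms by (simp add: sym_group_def permutes_surj)
  then have eq: "k \<circ> p = l \<circ> p \<longleftrightarrow> k = l" for k l :: "'n \<Rightarrow> 'd"
    by (auto simp: fun_eq_iff) (metis surjD)
  show ?thesis
    by (simp add: perm_op_eq[OF assms] vec_eq_iff matrix_matrix_mult_def cadjoint_def mat_def eq
        if_distrib[of cnj] if_distrib[of "\<lambda>c. c * _"] cong: if_cong)
qed

end

theory Submission
  imports Defs
begin

text \<open>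
  Conjugation by \<open>U\<^sup>\<pi>\<close> is linear in \<open>\<eta>\<close>, and since the entries of \<open>U\<^sup>\<pi>\<close> are \<open>0\<close> or \<open>1\<close>, its
  coefficients form a point of a \<^emph>\<open>real\<close> space of dimension \<open>(d\<^sup>n)\<^sup>4\<close>. The twirl over \<open>S\<^sub>n\<close> is the
  barycentre of these points, so by Caratheodory's theorem it is a convex combination of at most
  \<open>d\<^bsup>4n\<^esup> + 1\<close> of them.
\<close>

text \<open>Caratheodory's theorem counts points and allows zero weights, while a design counts
  indices and needs positive weights; this version bridges the gap.\<close>

lemma convex_combination_image_Caratheodory:
  fixes f :: "'a \<Rightarrow> 'b::euclidean_space"
  assumes "y \<in> convex hull (f ` A)"
  obtains X w where "finite X" "X \<subseteq> A" "card X \<le> DIM('b) + 1"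
    "\<forall>x\<in>X. 0 < w x" "sum w X = 1" "(\<Sum>x\<in>X. w x *\<^sub>R f x) = y"
proof -
  from assms obtain S where S: "finite S" "S \<subseteq> f ` A" "card S \<le> DIM('b) + 1"
      "y \<in> convex hull S"
    by (auto simp: caratheodory[of "f ` A"])
  \<comment> \<open>\<open>f\<close> may identify elements of \<open>A\<close>, so one preimage per
    point of \<open>S\<close> is kept; sums over \<open>S\<close> then reindex to
    \<open>B\<close>.\<close>
  then obtain B where B: "B \<subseteq> A" "inj_on f B" "S = f ` B"
    by (auto simp: subset_image_inj)
  have finB: "finite B" using S(1) B finite_imageD by blast
  from S(1,4) obtain u where u: "\<forall>s\<in>S. 0 \<le> u s" "sum u S = 1" "(\<Sum>s\<in>S. u s *\<^sub>R s) = y"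
    by (auto simp: convex_hull_finite)
  \<comment> \<open>Discarding weight zero makes the weights strictly positive and changes neither
    sum.\<close>
  define X where "X = {x \<in> B. 0 < u (f x)}"
  have XB: "X \<subseteq> B" by (auto simp: X_def)
  have zero: "u (f x) = 0" if "x \<in> B - X" for x
    using that u(1) B(3) by (force simp: X_def)
  show thesis
  proof
    show "finite X" "X \<subseteq> A" using XB B(1) finB finite_subset by auto
    have "card X \<le> card B" using XB finB by (rule card_mono[rotated])
    with S(3) show "card X \<le> DIM('b) + 1" using B by (simp add: card_image)
    show "\<forall>x\<in>X. 0 < (u \<circ> f) x" by (simp add: X_def)
    have "sum (u \<circ> f) X = sum (u \<circ> f) B"
      by (rule sum.mono_neutral_left) (use finB XB zero in auto)
    then show "sum (u \<circ> f) X = 1" using u(2) B by (simp add: sum.reindex)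
    have "(\<Sum>x\<in>X. (u \<circ> f) x *\<^sub>R f x) = (\<Sum>x\<in>B. (u \<circ> f) x *\<^sub>R f x)"
      by (rule sum.mono_neutral_left) (use finB XB zero in auto)
    then show "(\<Sum>x\<in>X. (u \<circ> f) x *\<^sub>R f x) = y" using u(3) B by (simp add: sum.reindex)
  qed
qed

type_synonym ('d, 'n) tpow_superop =
  "(real, ('n \<Rightarrow> 'd) \<times> ('n \<Rightarrow> 'd) \<times> ('n \<Rightarrow> 'd) \<times> ('n \<Rightarrow> 'd)) vec"

text \<open>
  The entry at \<open>(a, b, c, e)\<close> is the coefficient of \<open>\<eta>\<^bsub>bc\<^esub>\<close> in the entry \<open>(a, e)\<close> of
  \<open>U\<^sup>\<pi> \<eta> U\<^sup>\<pi>\<^sup>\<dagger>\<close>.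
\<close>

definition conj_coeffs :: "('n::finite \<Rightarrow> 'n) \<Rightarrow> ('d::finite, 'n) tpow_superop" where
  "conj_coeffs p = vec_lambda (\<lambda>(a, b, c, e). if a = b \<circ> p \<and> e = c \<circ> p then 1 else 0)"

lemma perm_op_conj_nth:
  fixes \<eta> :: "('d::finite, 'n::finite) tpow_op"
  assumes "p \<in> sym_group"
  shows "(perm_op p ** \<eta> ** cadjoint (perm_op p)) $ a $ e =
    (\<Sum>c\<in>UNIV. \<Sum>b\<in>UNIV. (conj_coeffs p $ (a, b, c, e)) *\<^sub>R \<eta> $ b $ c)"
  by (auto simp: perm_op_eq[OF assms] matrix_matrix_mult_def cadjoint_def conj_coeffs_def
      intro!: sum.cong)

lemma sum_perm_op_conj_nth:
  fixes \<eta> :: "('d::finite, 'n::finite) tpow_op"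
  assumes "X \<subseteq> sym_group"
  shows "(\<Sum>p\<in>X. w p *\<^sub>R (perm_op p ** \<eta> ** cadjoint (perm_op p))) $ a $ e =
    (\<Sum>c\<in>UNIV. \<Sum>b\<in>UNIV. ((\<Sum>p\<in>X. w p *\<^sub>R conj_coeffs p) $ (a, b, c, e)) *\<^sub>R \<eta> $ b $ c)"
proof -
  have "(\<Sum>p\<in>X. w p *\<^sub>R (perm_op p ** \<eta> ** cadjoint (perm_op p))) $ a $ e =
      (\<Sum>p\<in>X. \<Sum>c\<in>UNIV. \<Sum>b\<in>UNIV. (w p * conj_coeffs p $ (a, b, c, e)) *\<^sub>R \<eta> $ b $ c)"
    using assms by (auto simp: perm_op_conj_nth subset_iff scaleR_sum_right intro!: sum.cong)
  also have "\<dots> = (\<Sum>c\<in>UNIV. \<Sum>b\<in>UNIV. \<Sum>p\<in>X. (w p * conj_coeffs p $ (a, b, c, e)) *\<^sub>R \<eta> $ b $ c)"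
    by (subst sum.swap) (rule sum.cong[OF refl], rule sum.swap)
  finally show ?thesis by (simp add: scaleR_sum_left)
qed

text \<open>The weights enter the twirl only through the weighted sum of coefficient vectors, so the
  condition for all \<eta> follows from one vector equation.\<close>

lemma symmetric_weighted_designI:
  assumes "X \<subseteq> sym_group" "\<forall>p\<in>X. 0 < w p" "sum w X = 1"
    and "(\<Sum>p\<in>X. w p *\<^sub>R conj_coeffs p) =
      (\<Sum>p\<in>sym_group. (1 / fact CARD('n)) *\<^sub>R conj_coeffs p ::
        ('d::finite, 'n::finite) tpow_superop)"
  shows "symmetric_weighted_design TYPE('d) X w"
  unfolding symmetric_weighted_design_def scaleR_sum_right
proof (intro conjI allI)
  fix \<eta> :: "('d, 'n) tpow_op"
  show "(\<Sum>p\<in>sym_group. (1 / fact CARD('n)) *\<^sub>R (perm_op p ** \<eta> ** cadjoint (perm_op p))) =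
      (\<Sum>p\<in>X. w p *\<^sub>R (perm_op p ** \<eta> ** cadjoint (perm_op p)))"
    \<comment> \<open>The left side is the case of all of \<open>sym_group\<close> with constant
      weight 1/n!, so one entry formula rewrites both sides.\<close>
    unfolding vec_eq_iff using assms(1,4)
    by (intro allI) (simp only: sum_perm_op_conj_nth subset_refl)
qed (use assms in auto)

lemma card_sym_group: "card (sym_group :: ('n::finite \<Rightarrow> 'n) set) = fact CARD('n)"
  by (simp add: sym_group_def card_permutations)

theorem theorem3:
  "\<exists>(X :: ('n::finite \<Rightarrow> 'n) set) \<omega>.
     symmetric_weighted_design TYPE('d::finite) X \<omega> \<and>
     card X \<le> CARD('d) ^ (4 * CARD('n)) + 1"
proof -
  have "(\<Sum>p\<in>sym_group. (1 / fact CARD('n)) *\<^sub>R conj_coeffs p :: ('d, 'n) tpow_superop)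
      \<in> convex hull (conj_coeffs ` sym_group)"
    by (rule convex_sum) (auto simp: card_sym_group intro: hull_inc)
  then obtain X w where X: "X \<subseteq> sym_group" "card X \<le> DIM(('d, 'n) tpow_superop) + 1"
      "\<forall>p\<in>X. 0 < w p" "sum w X = 1"
      "(\<Sum>p\<in>X. w p *\<^sub>R conj_coeffs p) =
        (\<Sum>p\<in>sym_group. (1 / fact CARD('n)) *\<^sub>R conj_coeffs p :: ('d, 'n) tpow_superop)"
    by (rule convex_combination_image_Caratheodory)
  \<comment> \<open>One real coordinate per quadruple of multi-indices, of which there are
    d^n.\<close>
  have "DIM(('d, 'n) tpow_superop) = (CARD('d) ^ CARD('n)) ^ 4"
    by (simp add: card_fun power4_eq_xxxx mult.assoc)
  also have "\<dots> = CARD('d) ^ (4 * CARD('n))"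
    by (simp only: power_mult[symmetric] mult.commute)
  finally have "card X \<le> CARD('d) ^ (4 * CARD('n)) + 1"
    using X(2) by simp
  moreover have "symmetric_weighted_design TYPE('d) X w"
    using X(1,3,4,5) by (rule symmetric_weighted_designI)
  ultimately show ?thesis by blast
qed

end
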